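(* Let $\mathbb{G}$ be an infinite connected graph of bounded degree with $\imath_E^*(\mathbb{G})>0$, and let $\nu$ be a probability distribution on the positive integers. If $\nu$ has an exponential tail, then the random stretch $\mathbb{G}^\nu$ satisfies $\imath_E^*(\mathbb{G}^\nu)>0$ almost surely.
   Context: For a graph $G$ and $S\subset V(G)$, $|S|$ is the cardinality of $S$, and $\partial S$ is the set of edges of $G$ with one end in $S$ and the other in $S^c$. $S$ is connected if the subgraph induced on $S$ is connected. For an infinite connected graph $G$ with basepoint $o$, the anchored expansion constant is $$\imath_E^*(G):=\lim_{n\to\infty}\inf\left\{\frac{|\partial S|}{|S|}: o\in S\subset V(G),\ S\text{ is connected},\ n\le |S|<\infty\right\};$$ it does not depend on $o$. Random stretch: let $\{L_e\}_{e\in E(\mathbb{G})}$ be independent random variables with law $\nu$, and replace each edge $e$ of $\mathbb{G}$ by a path consisting of $L_e$ new edges (joining the same two endpoints); the resulting random graph is $\mathbb{G}^\nu$. The law $\nu$ has an exponential tail if there is $\varepsilon>0$ such that $\nu[\ell,\infty)<e^{-\varepsilon\ell}$ for all sufficiently large $\ell$. *)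

theory Defs
  imports "HOL-Probability.Probability" "Graph_Theory.Digraph_Component"
begin

text \<open>
  An undirected graph (loops and multiple edges allowed) is represented by a
  \<^locale>\<open>wf_digraph\<close> in which every undirected edge occurs as exactly one arc, oriented
  arbitrarily.  All notions below ignore the orientation; \<^const>\<open>Digraph_Component.connected\<close>
  is connectedness of the underlying undirected graph.  The full name is needed to tell it from
  the topological notion.
\<close>

text \<open>The degree is \<^term>\<open>in_degree G v + out_degree G v\<close>, so a loop counts twice.\<close>

definition bounded_degree :: "('v, 'e) pre_digraph \<Rightarrow> bool" where
  "bounded_degree G \<longleftrightarrow>
     (\<exists>D. \<forall>v\<in>verts G. finite (in_arcs G v) \<and> finite (out_arcs G v) \<and>
        in_degree G v + out_degree G v \<le> D)"

definition edge_boundary :: "('v, 'e) pre_digraph \<Rightarrow> 'v set \<Rightarrow> 'e set" where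
  "edge_boundary G S =
     {e \<in> arcs G. (tail G e \<in> S \<and> head G e \<notin> S) \<or> (tail G e \<notin> S \<and> head G e \<in> S)}"

definition connected_sets_from :: "('v, 'e) pre_digraph \<Rightarrow> 'v \<Rightarrow> nat \<Rightarrow> 'v set set" where
  "connected_sets_from G b n =
     {S. b \<in> S \<and> S \<subseteq> verts G \<and> Digraph_Component.connected (induce_subgraph G S) \<and>
         finite S \<and> n \<le> card S}"

text \<open>
  The infimum is taken in \<^typ>\<open>ereal\<close>, where it is nondecreasing in \<open>n\<close>, so that the limit always
  exists.  Since \<^const>\<open>card\<close> of an infinite set is 0, the definition is meant for locally finite
  graphs, in which the boundary of a finite set is finite.
\<close>

definition anchored_expansion :: "('v, 'e) pre_digraph \<Rightarrow> 'v \<Rightarrow> ereal" where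
  "anchored_expansion G b =
     lim (\<lambda>n. INF S\<in>connected_sets_from G b n.
                ereal (real (card (edge_boundary G S)) / real (card S)))"

lemma anchored_expansion_LIMSEQ:
  "(\<lambda>n. INF S\<in>connected_sets_from G b n.
          ereal (real (card (edge_boundary G S)) / real (card S)))
     \<longlonglongrightarrow> anchored_expansion G b"
proof -
  let ?X = "\<lambda>n. INF S\<in>connected_sets_from G b n.
          ereal (real (card (edge_boundary G S)) / real (card S))"
  have "incseq ?X"
    by (intro monoI INF_superset_mono) (auto simp: connected_sets_from_def)
  then have "?X \<longlonglongrightarrow> (SUP n. ?X n)"
    by (rule LIMSEQ_SUP)
  then show ?thesis
    unfolding anchored_expansion_def by (simp add: limI)
qed

text \<open>
  \<open>stretch G l\<close> replaces each edge \<open>e\<close> by a path of \<open>l e\<close> edges \<open>(e, 0), \<dots>, (e, l e - 1)\<close>,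
  traversed from the tail to the head of \<open>e\<close>, with new inner vertices
  \<open>Inr (e, 1), \<dots>, Inr (e, l e - 1)\<close>; the old vertex \<open>v\<close> becomes \<open>Inl v\<close>.  This is the intended
  construction when \<open>l e \<ge> 1\<close> for every edge \<open>e\<close>.
\<close>

definition stretch ::
    "('v, 'e) pre_digraph \<Rightarrow> ('e \<Rightarrow> nat) \<Rightarrow> ('v + 'e \<times> nat, 'e \<times> nat) pre_digraph" where
  "stretch G l =
     \<lparr> verts = Inl ` verts G \<union> Inr ` {(e, i). e \<in> arcs G \<and> 1 \<le> i \<and> i < l e},
       arcs = {(e, i). e \<in> arcs G \<and> i < l e},
       tail = (\<lambda>(e, i). if i = 0 then Inl (tail G e) else Inr (e, i)),
       head = (\<lambda>(e, i). if Suc i = l e then Inl (head G e) else Inr (e, Suc i)) \<rparr>"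

lemma wf_digraph_stretch:
  assumes "wf_digraph G"
  shows "wf_digraph (stretch G l)"
proof -
  interpret wf_digraph G by fact
  show ?thesis
    by unfold_locales (auto simp: stretch_def)
qed

definition exponential_tail :: "nat pmf \<Rightarrow> bool" where
  "exponential_tail \<nu> \<longleftrightarrow>
     (\<exists>\<epsilon>>0. \<forall>\<^sub>F k in sequentially. measure_pmf.prob \<nu> {k..} < exp (- \<epsilon> * real k))"

end

theory Submission
  imports Defs
begin

text \<open>
  Consider a finite connected vertex set \<open>S\<close> of the stretched graph, and let \<open>S\<^sub>0\<close> be the set of the
  original vertices in it. If \<open>S\<^sub>0\<close> is nonempty, then it is connected in \<open>G\<close>. The boundary of \<open>S\<close> is
  at least as large as that of \<open>S\<^sub>0\<close>, because the path that replaces an edge leaving \<open>S\<^sub>0\<close> must itself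
  leave \<open>S\<close> somewhere. On the other hand \<open>S\<close> then has at most \<open>card S\<^sub>0 + (\<Sum>e. L e)\<close> vertices, the sum
  being over the edges that touch \<open>S\<^sub>0\<close>. So anchored expansion passes from \<open>G\<close> to the
  stretched graph as soon as these sums are almost surely at most a constant times \<open>card S\<^sub>0\<close>, for
  all large connected \<open>S\<^sub>0\<close> containing the basepoint.

  For this a union bound is enough. In a graph of bounded degree the number of connected sets of
  \<open>n\<close> vertices containing a given vertex grows at most exponentially
  (\<open>card_connected_sets\<close>): each such set is traced out by a walk of \<open>2 * (n - 1)\<close> steps. Each of them
  touches at most \<open>D * n\<close> edges, and since \<open>\<nu>\<close> has an exponential moment, the probability that the
  lengths of these edges add up to more than \<open>C * n\<close> is at most \<open>q ^ n\<close>, where \<open>q\<close> is as small as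
  desired for large \<open>C\<close>. The first Borel--Cantelli lemma concludes
  (\<open>eventually_all_sums_le_linear\<close>).

  A basepoint \<open>x\<close> of the stretched graph other than \<open>b\<close> is dealt with by replacing \<open>S\<^sub>0\<close> by its
  union with a fixed finite connected set \<open>P\<close> that contains \<open>b\<close> and either \<open>x\<close> itself or, when \<open>x\<close>
  is a new vertex, an end of the edge on which it lies. This changes the boundary by at most a
  constant, and it makes the case of empty \<open>S\<^sub>0\<close> harmless
  (\<open>connected_set_in_stretch\<close>, \<open>anchored_expansion_stretch_pos\<close>).
\<close>

section \<open>Connected vertex sets\<close>

text \<open>Adjacency in the underlying undirected graph.\<close>

definition adj :: "('v, 'e) pre_digraph \<Rightarrow> 'v rel" where
  "adj G = {(u, v). \<exists>e\<in>arcs G. (u = tail G e \<and> v = head G e) \<or> (u = head G e \<and> v = tail G e)}"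

text \<open>The edges with at least one end in \<open>S\<close>: the boundary of \<open>S\<close> and the edges inside \<open>S\<close>.\<close>

definition touching :: "('v, 'e) pre_digraph \<Rightarrow> 'v set \<Rightarrow> 'e set" where
  "touching G S = {e \<in> arcs G. tail G e \<in> S \<or> head G e \<in> S}"

lemma sym_adj: "sym (adj G)"
  by (auto simp: adj_def sym_def)

lemma parcs_mk_symmetric_induce:
  "parcs (mk_symmetric (induce_subgraph G S)) = Restr (adj G) S"
  by (auto simp: mk_symmetric_def induce_subgraph_def adj_def)

lemma rtrancl_on_eq_rtrancl_Restr:
  "rtrancl_on S (Restr R S) = {(u, v). u \<in> S \<and> (u, v) \<in> (Restr R S)\<^sup>*}"
proof (intro equalityI subsetI; clarify)
  fix u v assume "(u, v) \<in> rtrancl_on S (Restr R S)"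
  then show "u \<in> S \<and> (u, v) \<in> (Restr R S)\<^sup>*"
    using in_rtrancl_on_in_F rtrancl_on_rtranclI by metis
next
  fix u v assume "(u, v) \<in> (Restr R S)\<^sup>*" "u \<in> S"
  then show "(u, v) \<in> rtrancl_on S (Restr R S)"
    by (induction rule: rtrancl_induct) (auto intro: rtrancl_on_into_rtrancl_on)
qed

text \<open>
  Because adjacency is symmetric, it is enough that all of \<open>S\<close> can be reached from one vertex
  \<open>b\<close> inside \<open>S\<close>.
\<close>

lemma connected_induce_iff:
  assumes "b \<in> S"
  shows "Digraph_Component.connected (induce_subgraph G S) \<longleftrightarrow>
           (\<forall>v\<in>S. (b, v) \<in> (Restr (adj G) S)\<^sup>*)"
proof -
  have conn: "Digraph_Component.connected (induce_subgraph G S) \<longleftrightarrow>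
      (\<forall>u\<in>S. \<forall>v\<in>S. (u, v) \<in> (Restr (adj G) S)\<^sup>*)"
    using assms
    by (simp add: Digraph_Component.connected_def strongly_connected_def reachable_def
        parcs_mk_symmetric_induce rtrancl_on_eq_rtrancl_Restr) blast
  have "sym (Restr (adj G) S)"
    using sym_adj[of G] by (auto simp: sym_def)
  then have "sym ((Restr (adj G) S)\<^sup>*)"
    by (rule sym_rtrancl)
  then show ?thesis
    unfolding conn using assms by (meson rtrancl_trans symD)
qed

lemma connected_sets_from_iff:
  "S \<in> connected_sets_from G b n \<longleftrightarrow>
     b \<in> S \<and> S \<subseteq> verts G \<and> (\<forall>v\<in>S. (b, v) \<in> (Restr (adj G) S)\<^sup>*) \<and> finite S \<and> n \<le> card S"
  unfolding connected_sets_from_def using connected_induce_iff[of b S G] by auto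

lemma connected_imp_rtrancl_adj:
  assumes "Digraph_Component.connected G" "u \<in> verts G" "v \<in> verts G"
  shows "(u, v) \<in> (adj G)\<^sup>*"
proof -
  have "parcs (mk_symmetric G) = adj G"
    by (auto simp: mk_symmetric_def adj_def)
  then have "(u, v) \<in> rtrancl_on (verts G) (adj G)"
    using assms by (simp add: Digraph_Component.connected_def strongly_connected_def reachable_def)
  then show ?thesis
    by (rule rtrancl_on_rtranclI)
qed

lemma edge_boundary_subset_touching: "edge_boundary G S \<subseteq> touching G S"
  by (auto simp: edge_boundary_def touching_def)

lemma ex_connected_set_containing:
  assumes "wf_digraph G" "Digraph_Component.connected G" "b \<in> verts G" "v \<in> verts G"
  shows "\<exists>P\<in>connected_sets_from G b 0. v \<in> P"
  using connected_imp_rtrancl_adj[OF assms(2-4)]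
proof (induction rule: rtrancl_induct)
  case base
  then show ?case
    using assms(3) by (intro bexI[of _ "{b}"]) (auto simp: connected_sets_from_iff)
next
  case (step u v)
  then obtain P where P: "P \<in> connected_sets_from G b 0" "u \<in> P"
    by blast
  let ?P = "insert v P"
  have reach: "(b, w) \<in> (Restr (adj G) ?P)\<^sup>*" if "w \<in> P" for w
  proof -
    have "(b, w) \<in> (Restr (adj G) P)\<^sup>*"
      using P(1) that by (simp add: connected_sets_from_iff)
    then show ?thesis
      by (rule rtrancl_mono[THEN subsetD, rotated]) auto
  qed
  have "(u, v) \<in> Restr (adj G) ?P"
    using step(2) P(2) by auto
  then have "(b, v) \<in> (Restr (adj G) ?P)\<^sup>*"
    using reach[OF P(2)] by (rule rtrancl_into_rtrancl[rotated])
  moreover have "v \<in> verts G"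
    using step(2) wf_digraph.wellformed[OF assms(1)] by (auto simp: adj_def)
  ultimately show ?case
    using P(1) reach by (intro bexI[of _ ?P]) (auto simp: connected_sets_from_iff)
qed

section \<open>Counting connected sets\<close>

text \<open>Walks of \<open>m\<close> steps starting in \<open>b\<close>, as lists of \<open>m + 1\<close> vertices.\<close>

definition walks :: "'v rel \<Rightarrow> 'v \<Rightarrow> nat \<Rightarrow> 'v list set" where
  "walks R b m = {w. length w = Suc m \<and> hd w = b \<and> successively (\<lambda>x y. (x, y) \<in> R) w}"

lemma walks_Suc: "walks R b (Suc m) = (\<Union>v\<in>R `` {b}. (#) b ` walks R v m)"
proof (intro equalityI subsetI)
  fix w assume "w \<in> walks R b (Suc m)"
  then obtain x v w' where "w = x # v # w'" "x = b"
    by (auto simp: walks_def length_Suc_conv)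
  with \<open>w \<in> _\<close> have "(b, v) \<in> R" "v # w' \<in> walks R v m" "w = b # v # w'"
    by (auto simp: walks_def)
  then show "w \<in> (\<Union>v\<in>R `` {b}. (#) b ` walks R v m)"
    by blast
next
  fix w assume "w \<in> (\<Union>v\<in>R `` {b}. (#) b ` walks R v m)"
  then show "w \<in> walks R b (Suc m)"
    by (auto simp: walks_def length_Suc_conv)
qed

lemma card_walks:
  assumes "\<And>v. finite (R `` {v})" "\<And>v. card (R `` {v}) \<le> D"
  shows "finite (walks R b m) \<and> card (walks R b m) \<le> D ^ m"
proof (induction m arbitrary: b)
  case 0
  have "walks R b 0 = {[b]}"
    by (auto simp: walks_def length_Suc_conv)
  then show ?case
    by simp
next
  case (Suc m)
  have "card (walks R b (Suc m)) \<le> (\<Sum>v\<in>R `` {b}. card ((#) b ` walks R v m))"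
    unfolding walks_Suc using assms(1) by (rule card_UN_le)
  also have "\<dots> \<le> (\<Sum>v\<in>R `` {b}. D ^ m)"
    using Suc by (intro sum_mono) (metis card_image_le order_trans)
  also have "\<dots> \<le> D ^ Suc m"
    using assms(2) by simp
  finally show ?case
    unfolding walks_Suc using assms(1) Suc by auto
qed

text \<open>
  Inside a connected set a walk can be made to visit one more vertex at the cost of two steps: where
  it passes through a vertex \<open>u\<close> that has an unvisited neighbour \<open>v\<close>, insert the detour from
  \<open>u\<close> to \<open>v\<close> and back.
\<close>

lemma connected_set_covered_by_walk:
  assumes R: "sym R" and conn: "b \<in> S" "\<forall>v\<in>S. (b, v) \<in> (Restr R S)\<^sup>*" and "finite S"
    and "Suc k \<le> card S"
  shows "\<exists>w\<in>walks R b (2 * k). set w \<subseteq> S \<and> card (set w) = Suc k"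
  using \<open>Suc k \<le> card S\<close>
proof (induction k)
  case 0
  then show ?case
    using conn by (intro bexI[of _ "[b]"]) (auto simp: walks_def)
next
  case (Suc k)
  then obtain w where w: "w \<in> walks R b (2 * k)" "set w \<subseteq> S" "card (set w) = Suc k"
    by auto
  have "w \<noteq> []" "hd w = b"
    using w(1) by (auto simp: walks_def)
  then have "b \<in> set w"
    by (metis hd_in_set)
  have "set w \<noteq> S"
    using w(3) Suc.prems by auto
  have "\<exists>(u, v)\<in>Restr R S. u \<in> set w \<and> v \<notin> set w"
  proof (rule ccontr)
    assume neg: "\<not> ?thesis"
    have "v \<in> set w" if "(b, v) \<in> (Restr R S)\<^sup>*" for v
      using that \<open>b \<in> set w\<close> neg by (induction rule: rtrancl_induct) blast+
    then show False
      using conn(2) \<open>set w \<noteq> S\<close> w(2) by blast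
  qed
  then obtain u v where uv: "(u, v) \<in> R" "u \<in> set w" "v \<in> S" "v \<notin> set w"
    by auto
  then have "(v, u) \<in> R"
    using R by (auto dest: symD)
  obtain w1 w2 where w12: "w = w1 @ u # w2"
    using uv(2) by (meson split_list)
  let ?w = "w1 @ u # v # u # w2"
  have "?w \<in> walks R b (2 * Suc k)"
    using w(1) uv(1) \<open>(v, u) \<in> R\<close> unfolding w12 walks_def
    by (auto simp: successively_append_iff successively_Cons hd_append split: if_splits)
  moreover have "set ?w = insert v (set w)"
    unfolding w12 by auto
  ultimately show ?case
    using w(2,3) uv(3,4) by (intro bexI[of _ ?w]) auto
qed

lemma card_connected_sets:
  assumes deg: "\<And>v. finite (adj G `` {v})" "\<And>v. card (adj G `` {v}) \<le> D"
  shows "finite {S \<in> connected_sets_from G b 0. card S = n} \<and>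
         card {S \<in> connected_sets_from G b 0. card S = n} \<le> D ^ (2 * (n - 1))"
proof -
  let ?W = "walks (adj G) b (2 * (n - 1))"
  have sub: "{S \<in> connected_sets_from G b 0. card S = n} \<subseteq> set ` ?W"
  proof clarify
    fix S assume S: "S \<in> connected_sets_from G b 0" and n: "n = card S"
    then have "finite S" "b \<in> S"
      by (auto simp: connected_sets_from_iff)
    then have "card S > 0"
      by (auto simp: card_gt_0_iff)
    with S n obtain w where "w \<in> ?W" "set w \<subseteq> S" "card (set w) = card S"
      using connected_set_covered_by_walk[OF sym_adj, of b S G "n - 1"]
      by (auto simp: connected_sets_from_iff)
    then show "S \<in> set ` walks (adj G) b (2 * (card S - 1))"
      using \<open>finite S\<close> n card_subset_eq by blast
  qed
  have W: "finite ?W" "card ?W \<le> D ^ (2 * (n - 1))"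
    using card_walks[OF deg] by auto
  have "card {S \<in> connected_sets_from G b 0. card S = n} \<le> card (set ` ?W)"
    using sub W(1) by (intro card_mono) auto
  also have "\<dots> \<le> D ^ (2 * (n - 1))"
    using card_image_le[OF W(1)] W(2) order_trans by blast
  finally show ?thesis
    using finite_subset[OF sub] W(1) by auto
qed

text \<open>Taking \<open>D \<ge> 1\<close> makes powers of \<open>D\<close> increasing in the exponent.\<close>

lemma bounded_degreeE:
  assumes "wf_digraph G" "bounded_degree G"
  obtains D where "1 \<le> D" "\<And>v. finite (adj G `` {v})" "\<And>v. card (adj G `` {v}) \<le> D"
    "\<And>S. finite S \<Longrightarrow> finite (touching G S) \<and> card (touching G S) \<le> D * card S"
proof -
  interpret wf_digraph G by fact
  obtain D where D: "\<And>v. v \<in> verts G \<Longrightarrow> finite (in_arcs G v) \<and> finite (out_arcs G v) \<and>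
      in_degree G v + out_degree G v \<le> D"
    using assms(2) unfolding bounded_degree_def by blast
  have empty: "in_arcs G v = {}" "out_arcs G v = {}" if "v \<notin> verts G" for v
    using that wellformed by (auto simp: in_arcs_def out_arcs_def)
  have fin: "finite (in_arcs G v \<union> out_arcs G v)" for v
    using D empty by (cases "v \<in> verts G") auto
  have card: "card (in_arcs G v \<union> out_arcs G v) \<le> D" for v
    using D[of v] empty[of v] card_Un_le[of "in_arcs G v" "out_arcs G v"]
    by (cases "v \<in> verts G") (auto simp: in_degree_def out_degree_def)
  have fin': "finite (touching G S)" and card': "card (touching G S) \<le> D * card S" if "finite S" for S
  proof -
    have eq: "touching G S = (\<Union>v\<in>S. in_arcs G v \<union> out_arcs G v)"
      by (auto simp: touching_def)
    show "finite (touching G S)"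
      unfolding eq using that fin by blast
    have "card (touching G S) \<le> (\<Sum>v\<in>S. card (in_arcs G v \<union> out_arcs G v))"
      unfolding eq using that by (rule card_UN_le)
    also have "\<dots> \<le> D * card S"
      using sum_bounded_above[of S "\<lambda>v. card (in_arcs G v \<union> out_arcs G v)" D] card
      by (simp add: mult.commute)
    finally show "card (touching G S) \<le> D * card S" .
  qed
  have adj: "adj G `` {v} = (\<lambda>e. if tail G e = v then head G e else tail G e) ` touching G {v}" for v
    by (auto simp: adj_def touching_def image_iff)
  show thesis
  proof (rule that[of "max 1 D"])
    fix v
    show "finite (adj G `` {v})"
      unfolding adj using fin' by simp
    have "card (adj G `` {v}) \<le> card (touching G {v})"
      unfolding adj using fin' by (intro card_image_le) simp
    also have "\<dots> \<le> max 1 D"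
      using card'[of "{v}"] by simp
    finally show "card (adj G `` {v}) \<le> max 1 D" .
  next
    fix S :: "'a set" assume "finite S"
    then show "finite (touching G S) \<and> card (touching G S) \<le> max 1 D * card S"
      using fin' card' by (meson max.cobounded2 mult_le_mono1 order_trans)
  qed simp
qed

lemma countable_arcs:
  assumes wf: "wf_digraph G" and conn: "Digraph_Component.connected G" and b: "b \<in> verts G"
    and fin_touching: "\<And>S. finite S \<Longrightarrow> finite (touching G S)"
    and fin_sets: "\<And>n. finite {T \<in> connected_sets_from G b 0. card T = n}"
  shows "countable (arcs G)"
proof -
  have "arcs G \<subseteq> (\<Union>n. \<Union>T\<in>{T \<in> connected_sets_from G b 0. card T = n}. touching G T)"
  proof
    fix e assume e: "e \<in> arcs G"
    then have "tail G e \<in> verts G"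
      using wf by (rule wf_digraph.tail_in_verts[rotated])
    then obtain T where "T \<in> connected_sets_from G b 0" "tail G e \<in> T"
      using ex_connected_set_containing[OF wf conn b] by blast
    with e show "e \<in> (\<Union>n. \<Union>T\<in>{T \<in> connected_sets_from G b 0. card T = n}. touching G T)"
      by (auto simp: touching_def)
  qed
  moreover have "finite (touching G T)" if "T \<in> connected_sets_from G b 0" for T
    using that fin_touching by (simp add: connected_sets_from_iff)
  then have "countable (\<Union>n. \<Union>T\<in>{T \<in> connected_sets_from G b 0. card T = n}. touching G T)"
    using fin_sets by (intro countable_UN countableI_type) (auto intro: countable_finite)
  ultimately show ?thesis
    by (rule countable_subset)
qed

section \<open>Anchored expansion as an isoperimetric inequality\<close>

lemma anchored_expansion_posD:
  assumes "anchored_expansion G b > 0"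
  obtains c :: real and N where "c > 0"
    "\<And>S. S \<in> connected_sets_from G b N \<Longrightarrow> c * real (card S) \<le> real (card (edge_boundary G S))"
proof -
  let ?f = "\<lambda>S. ereal (real (card (edge_boundary G S)) / real (card S))"
  have "\<forall>\<^sub>F n in sequentially. 0 < (INF S\<in>connected_sets_from G b n. ?f S)"
    using order_tendstoD(1)[OF anchored_expansion_LIMSEQ assms] .
  then obtain N where "0 < (INF S\<in>connected_sets_from G b N. ?f S)"
    by (auto simp: eventually_sequentially)
  then obtain c where c: "0 < ereal c" "ereal c < (INF S\<in>connected_sets_from G b N. ?f S)"
    using ereal_dense2 by blast
  show thesis
  proof (rule that)
    show "c > 0"
      using c(1) by simp
    fix S assume S: "S \<in> connected_sets_from G b N"
    then have "finite S" "S \<noteq> {}"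
      by (auto simp: connected_sets_from_def)
    then have "card S > 0"
      by (simp add: card_gt_0_iff)
    have "ereal c < ?f S"
      using less_INF_D[OF c(2) S] .
    then show "c * real (card S) \<le> real (card (edge_boundary G S))"
      using \<open>card S > 0\<close> by (simp add: field_simps)
  qed
qed

lemma anchored_expansion_posI:
  fixes c :: real
  assumes "c > 0"
    "\<And>S. S \<in> connected_sets_from G b N \<Longrightarrow> c * real (card S) \<le> real (card (edge_boundary G S))"
  shows "anchored_expansion G b > 0"
proof -
  let ?f = "\<lambda>S. ereal (real (card (edge_boundary G S)) / real (card S))"
  have "ereal c \<le> anchored_expansion G b"
  proof (rule LIMSEQ_le_const[OF anchored_expansion_LIMSEQ], intro exI allI impI INF_greatest)
    fix n S assume "N \<le> n" and S: "S \<in> connected_sets_from G b n"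
    then have "S \<in> connected_sets_from G b N" "finite S" "S \<noteq> {}"
      by (auto simp: connected_sets_from_def)
    then show "ereal c \<le> ?f S"
      using assms(2)[of S] by (simp add: field_simps card_gt_0_iff)
  qed
  moreover have "0 < ereal c"
    using assms(1) by simp
  ultimately show ?thesis
    by (rule less_le_trans[rotated])
qed

section \<open>A union bound for sums of independent variables with exponential tail\<close>

lemma exponential_tail_imp_exp_moment:
  assumes "exponential_tail \<nu>"
  obtains \<theta> :: real where "\<theta> > 0" "(\<integral>\<^sup>+k. ennreal (exp (\<theta> * real k)) \<partial>measure_pmf \<nu>) < \<infinity>"
proof -
  obtain \<epsilon> where \<epsilon>: "\<epsilon> > 0" "\<forall>\<^sub>F k in sequentially. measure_pmf.prob \<nu> {k..} < exp (- \<epsilon> * real k)"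
    using assms unfolding exponential_tail_def by auto
  define \<theta> where "\<theta> = \<epsilon> / 2"
  have "summable (\<lambda>k. pmf \<nu> k * exp (\<theta> * real k))"
  proof (rule summable_comparison_test_ev)
    show "\<forall>\<^sub>F k in sequentially. norm (pmf \<nu> k * exp (\<theta> * real k)) \<le> exp (- \<theta>) ^ k"
      using \<epsilon>(2)
    proof eventually_elim
      case (elim k)
      have "pmf \<nu> k \<le> measure_pmf.prob \<nu> {k..}"
        unfolding measure_pmf_single[symmetric]
        by (rule measure_pmf.finite_measure_mono) auto
      with elim have "pmf \<nu> k * exp (\<theta> * real k) \<le> exp (- \<epsilon> * real k) * exp (\<theta> * real k)"
        by (intro mult_right_mono) auto
      also have "\<dots> = exp (real k * - \<theta>)"
        by (simp add: \<theta>_def flip: exp_add)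
      also have "\<dots> = exp (- \<theta>) ^ k"
        by (rule exp_of_nat_mult)
      finally show ?case
        by simp
    qed
    show "summable (\<lambda>k. exp (- \<theta>) ^ k)"
      using \<epsilon>(1) by (intro summable_geometric) (simp add: \<theta>_def)
  qed
  then have "(\<Sum>k. ennreal (pmf \<nu> k * exp (\<theta> * real k))) \<noteq> \<top>"
    by (intro ennreal_suminf_neq_top) auto
  moreover have "(\<integral>\<^sup>+k. ennreal (exp (\<theta> * real k)) \<partial>measure_pmf \<nu>) =
      (\<Sum>k. ennreal (pmf \<nu> k * exp (\<theta> * real k)))"
    by (simp add: nn_integral_measure_pmf nn_integral_count_space_nat ennreal_mult)
  ultimately show thesis
    using \<epsilon>(1) by (intro that[of \<theta>]) (auto simp: \<theta>_def top.not_eq_extremum)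
qed

lemma (in prob_space) Chernoff_sum_nat:
  fixes L :: "'e \<Rightarrow> 'a \<Rightarrow> nat" and \<theta> a :: real
  assumes "finite J" and indep: "indep_vars (\<lambda>_. count_space UNIV) L J"
    and law: "\<And>e. e \<in> J \<Longrightarrow> distr M (count_space UNIV) (L e) = measure_pmf \<nu>"
    and "\<theta> > 0"
  shows "{\<omega>\<in>space M. a \<le> real (\<Sum>e\<in>J. L e \<omega>)} \<in> sets M"
    and "emeasure M {\<omega>\<in>space M. a \<le> real (\<Sum>e\<in>J. L e \<omega>)} \<le>
           ennreal (exp (- \<theta> * a)) * (\<integral>\<^sup>+k. ennreal (exp (\<theta> * real k)) \<partial>measure_pmf \<nu>) ^ card J"
proof -
  have meas: "L e \<in> measurable M (count_space UNIV)" if "e \<in> J" for e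
    using indep that by (auto simp: indep_vars_def)
  have [measurable]: "(\<lambda>\<omega>. real (\<Sum>e\<in>J. L e \<omega>)) \<in> borel_measurable M"
    using meas by measurable
  show "{\<omega>\<in>space M. a \<le> real (\<Sum>e\<in>J. L e \<omega>)} \<in> sets M"
    by measurable
  have "emeasure M {\<omega>\<in>space M. a \<le> real (\<Sum>e\<in>J. L e \<omega>)} \<le>
      ennreal (exp (- \<theta> * a)) *
        (\<integral>\<^sup>+\<omega>. ennreal (exp (\<theta> * real (\<Sum>e\<in>J. L e \<omega>))) * indicator (space M) \<omega> \<partial>M)"
    by (intro Chernoff_ineq_nn_integral_ge[OF \<open>\<theta> > 0\<close>]) measurable
  also have "(\<integral>\<^sup>+\<omega>. ennreal (exp (\<theta> * real (\<Sum>e\<in>J. L e \<omega>))) * indicator (space M) \<omega> \<partial>M) =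
      (\<integral>\<^sup>+\<omega>. (\<Prod>e\<in>J. ennreal (exp (\<theta> * real (L e \<omega>)))) \<partial>M)"
    using \<open>finite J\<close>
    by (intro nn_integral_cong) (simp add: prod_ennreal sum_distrib_left flip: exp_sum)
  also have "\<dots> = (\<Prod>e\<in>J. \<integral>\<^sup>+\<omega>. ennreal (exp (\<theta> * real (L e \<omega>))) \<partial>M)"
    using \<open>finite J\<close> indep by (intro indep_vars_nn_integral indep_vars_compose2[OF indep]) auto
  also have "\<dots> = (\<Prod>e\<in>J. \<integral>\<^sup>+k. ennreal (exp (\<theta> * real k)) \<partial>measure_pmf \<nu>)"
    using meas by (intro prod.cong refl) (simp add: nn_integral_distr flip: law)
  finally show "emeasure M {\<omega>\<in>space M. a \<le> real (\<Sum>e\<in>J. L e \<omega>)} \<le>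
      ennreal (exp (- \<theta> * a)) * (\<integral>\<^sup>+k. ennreal (exp (\<theta> * real k)) \<partial>measure_pmf \<nu>) ^ card J"
    by simp
qed

text \<open>
  There are only exponentially many index sets of linear size, so a Chernoff bound controls the
  sums over all of them simultaneously. No relation between the index sets is needed.
\<close>

lemma (in prob_space) eventually_all_sums_le_linear:
  fixes L :: "'e \<Rightarrow> 'a \<Rightarrow> nat" and F :: "nat \<Rightarrow> 'e set set"
  assumes indep: "indep_vars (\<lambda>_. count_space UNIV) L I"
    and law: "\<And>e. e \<in> I \<Longrightarrow> distr M (count_space UNIV) (L e) = measure_pmf \<nu>"
    and tail: "exponential_tail \<nu>"
    and F: "\<And>n. finite (F n)" "\<And>n. card (F n) \<le> A ^ n"
    and J: "\<And>n J. J \<in> F n \<Longrightarrow> J \<subseteq> I \<and> finite J \<and> card J \<le> D * n"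
  shows "\<exists>C\<ge>0. AE \<omega> in M. \<forall>\<^sub>F n in sequentially. \<forall>J\<in>F n. real (\<Sum>e\<in>J. L e \<omega>) \<le> C * real n"
proof -
  obtain \<theta> where \<theta>: "\<theta> > 0" "(\<integral>\<^sup>+k. ennreal (exp (\<theta> * real k)) \<partial>measure_pmf \<nu>) < \<infinity>"
    using tail by (rule exponential_tail_imp_exp_moment)
  define m where "m = max 1 (enn2real (\<integral>\<^sup>+k. ennreal (exp (\<theta> * real k)) \<partial>measure_pmf \<nu>))"
  have "1 \<le> m"
    by (simp add: m_def)
  have "(\<integral>\<^sup>+k. ennreal (exp (\<theta> * real k)) \<partial>measure_pmf \<nu>) =
      ennreal (enn2real (\<integral>\<^sup>+k. ennreal (exp (\<theta> * real k)) \<partial>measure_pmf \<nu>))"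
    using \<theta>(2) by simp
  also have "\<dots> \<le> ennreal m"
    by (intro ennreal_leI) (simp add: m_def)
  finally have m: "1 \<le> m" "(\<integral>\<^sup>+k. ennreal (exp (\<theta> * real k)) \<partial>measure_pmf \<nu>) \<le> ennreal m"
    using \<open>1 \<le> m\<close> by auto
  define A' where "A' = max 1 (real A)"
  have A': "1 \<le> A'" "real (card (F n)) \<le> A' ^ n" for n
  proof -
    have "real (card (F n)) \<le> real A ^ n"
      using F(2)[of n] by (simp flip: of_nat_power)
    also have "\<dots> \<le> A' ^ n"
      by (intro power_mono) (auto simp: A'_def)
    finally show "real (card (F n)) \<le> A' ^ n" .
  qed (simp add: A'_def)
  \<comment> \<open>\<open>C\<close> is chosen such that the factor \<open>exp (- \<theta> * C)\<close> from the Chernoff bound outweighs both the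
      number of index sets and the exponential moments, with \<open>1 / 2\<close> to spare.\<close>
  define q where "q = 2 * A' * m ^ D"
  have q: "1 \<le> q"
    using A'(1) m(1) one_le_power[of m D] mult_mono[of 1 A' 1 "m ^ D"] by (simp add: q_def)
  define C where "C = ln q / \<theta>"
  have expC: "exp (- \<theta> * C) = 1 / q"
    using \<theta>(1) q by (simp add: C_def exp_minus inverse_eq_divide)
  define B where "B n = (\<Union>J\<in>F n. {\<omega>\<in>space M. C * real n \<le> real (\<Sum>e\<in>J. L e \<omega>)})" for n
  have indepJ: "indep_vars (\<lambda>_. count_space UNIV) L J"
    and lawJ: "\<And>e. e \<in> J \<Longrightarrow> distr M (count_space UNIV) (L e) = measure_pmf \<nu>"
    and finJ: "finite J" if "J \<in> F n" for n J
    using J[OF that] indep_vars_subset[OF indep] law by auto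
  have meas: "{\<omega>\<in>space M. C * real n \<le> real (\<Sum>e\<in>J. L e \<omega>)} \<in> sets M" if "J \<in> F n" for n J
    by (rule Chernoff_sum_nat(1)[OF finJ[OF that] indepJ[OF that] lawJ[OF that] \<theta>(1)])
  then have B: "B n \<in> sets M" for n
    unfolding B_def using F(1) by blast
  have bound: "prob {\<omega>\<in>space M. C * real n \<le> real (\<Sum>e\<in>J. L e \<omega>)} \<le> (1 / q) ^ n * (m ^ D) ^ n"
    if "J \<in> F n" for n J
  proof -
    have "emeasure M {\<omega>\<in>space M. C * real n \<le> real (\<Sum>e\<in>J. L e \<omega>)} \<le>
        ennreal (exp (- \<theta> * (C * real n))) *
          (\<integral>\<^sup>+k. ennreal (exp (\<theta> * real k)) \<partial>measure_pmf \<nu>) ^ card J"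
      by (rule Chernoff_sum_nat(2)[OF finJ[OF that] indepJ[OF that] lawJ[OF that] \<theta>(1)])
    also have "\<dots> \<le> ennreal (exp (- \<theta> * (C * real n))) * ennreal m ^ card J"
      using m(2) by (intro mult_left_mono power_mono) auto
    also have "\<dots> = ennreal (exp (- \<theta> * (C * real n)) * m ^ card J)"
      using m(1) by (simp add: ennreal_mult ennreal_power)
    also have "\<dots> \<le> ennreal (exp (- \<theta> * (C * real n)) * m ^ (D * n))"
      using m(1) J[OF that] by (intro ennreal_leI mult_left_mono power_increasing) auto
    also have "exp (- \<theta> * (C * real n)) = exp (- \<theta> * C) ^ n"
      by (simp add: mult_ac flip: exp_of_nat_mult)
    finally show ?thesis
      using m(1) q unfolding expC by (simp add: emeasure_eq_measure power_mult)
  qed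
  have "prob (B n) \<le> (1 / 2) ^ n" for n
  proof -
    have "prob (B n) \<le> (\<Sum>J\<in>F n. prob {\<omega>\<in>space M. C * real n \<le> real (\<Sum>e\<in>J. L e \<omega>)})"
      unfolding B_def using F(1) meas by (intro finite_measure_subadditive_finite) auto
    also have "\<dots> \<le> (\<Sum>J\<in>F n. (1 / q) ^ n * (m ^ D) ^ n)"
      using bound by (intro sum_mono)
    also have "\<dots> \<le> A' ^ n * ((1 / q) ^ n * (m ^ D) ^ n)"
      using A'(2)[of n] m(1) q by (simp add: mult_right_mono)
    also have "\<dots> = (1 / 2) ^ n"
      using A'(1) m(1) by (simp add: q_def field_simps flip: power_mult_distrib)
    finally show ?thesis .
  qed
  then have "summable (\<lambda>n. prob (B n))"
    by (intro summable_comparison_test[OF _ summable_geometric[of "1 / 2 :: real"]]) auto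
  then have "AE \<omega> in M. \<forall>\<^sub>F n in sequentially. \<omega> \<in> space M - B n"
    using B by (intro borel_cantelli_AE1) (auto simp: emeasure_eq_measure)
  then have "AE \<omega> in M. \<forall>\<^sub>F n in sequentially. \<forall>J\<in>F n. real (\<Sum>e\<in>J. L e \<omega>) \<le> C * real n"
    by (elim AE_mp) (auto simp: B_def elim!: eventually_mono intro!: AE_I2)
  moreover have "C \<ge> 0"
    using q \<theta>(1) by (simp add: C_def)
  ultimately show ?thesis
    by blast
qed

section \<open>Stretching a graph\<close>

lemma card_edge_boundary_le_stretch:
  assumes len: "\<And>e. e \<in> arcs G \<Longrightarrow> 1 \<le> l e"
    and fin: "finite (edge_boundary (stretch G l) S)"
  shows "card (edge_boundary G {v. Inl v \<in> S}) \<le> card (edge_boundary (stretch G l) S)"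
proof -
  have "edge_boundary G {v. Inl v \<in> S} \<subseteq> fst ` edge_boundary (stretch G l) S"
  proof
    fix e assume e: "e \<in> edge_boundary G {v. Inl v \<in> S}"
    \<comment> \<open>\<open>p 0, \<dots>, p (l e)\<close> are the successive vertices of the path replacing \<open>e\<close>. One of its ends
        lies in \<open>S\<close> and the other does not, so some edge of the path crosses the boundary.\<close>
    define p where "p i = (if i = 0 then Inl (tail G e)
        else if i = l e then Inl (head G e) else Inr (e, i))" for i
    have arc: "(e, i) \<in> arcs (stretch G l)" "tail (stretch G l) (e, i) = p i"
      "head (stretch G l) (e, i) = p (Suc i)" if "i < l e" for i
      using that e by (auto simp: stretch_def p_def edge_boundary_def)
    have "\<exists>i<l e. (p i \<in> S) \<noteq> (p (Suc i) \<in> S)"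
    proof (rule ccontr)
      assume neg: "\<not> ?thesis"
      have "(p i \<in> S) = (p 0 \<in> S)" if "i \<le> l e" for i
        using that by (induction i) (use neg in auto)
      from this[of "l e"] show False
        using e len[of e] by (auto simp: p_def edge_boundary_def)
    qed
    then obtain i where "i < l e" "(p i \<in> S) \<noteq> (p (Suc i) \<in> S)"
      by blast
    then have "(e, i) \<in> edge_boundary (stretch G l) S"
      using arc by (auto simp: edge_boundary_def)
    then show "e \<in> fst ` edge_boundary (stretch G l) S"
      by force
  qed
  then show ?thesis
    using fin by (meson card_image_le card_mono finite_imageI order_trans)
qed

text \<open>
  The set \<open>T\<close> consists of the original vertices of \<open>S\<close> and of \<open>P\<close>. The set \<open>P\<close> supplies an end of
  the edge on which \<open>x\<close> lies when \<open>x\<close> is a new vertex, which covers the case that \<open>S\<close> does not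
  leave this edge.
\<close>

lemma connected_set_in_stretch:
  fixes G :: "('v, 'e) pre_digraph"
  assumes wf: "wf_digraph G"
    and S: "S \<in> connected_sets_from (stretch G l) x 0"
    and P: "P \<in> connected_sets_from G b 0"
    and x: "case x of Inl v \<Rightarrow> v \<in> P | Inr (e, i) \<Rightarrow> tail G e \<in> P"
  defines "T \<equiv> {v. Inl v \<in> S} \<union> P"
  shows "T \<in> connected_sets_from G b 0"
    and "S \<subseteq> Inl ` T \<union> Inr ` (SIGMA e:touching G T. {..<l e})"
proof -
  define R where "R = {v. (b, v) \<in> (Restr (adj G) T)\<^sup>*}"
  have "b \<in> T"
    using P by (auto simp: T_def connected_sets_from_iff)
  have "v \<in> T" if "(b, v) \<in> (Restr (adj G) T)\<^sup>*" for v
    using that \<open>b \<in> T\<close> by (induction rule: rtrancl_induct) auto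
  then have "R \<subseteq> T"
    by (auto simp: R_def)
  have "P \<subseteq> R"
  proof
    fix v assume "v \<in> P"
    then have "(b, v) \<in> (Restr (adj G) P)\<^sup>*"
      using P by (simp add: connected_sets_from_iff)
    moreover have "(Restr (adj G) P)\<^sup>* \<subseteq> (Restr (adj G) T)\<^sup>*"
      by (intro rtrancl_mono) (auto simp: T_def)
    ultimately show "v \<in> R"
      by (auto simp: R_def)
  qed
  have R_step: "v \<in> R" if "u \<in> R" "(u, v) \<in> adj G" "v \<in> T" for u v
    using that \<open>R \<subseteq> T\<close> unfolding R_def by (auto intro: rtrancl_into_rtrancl)
  \<comment> \<open>\<open>Q\<close> is invariant along walks in \<open>S\<close>: an original vertex of the walk is reachable from \<open>b\<close>
      in \<open>T\<close>, and at a new vertex, an end of the replaced edge is. Which end it is does not matter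
      when the walk arrives at the next original vertex.\<close>
  define Q where "Q y = (case y of Inl v \<Rightarrow> v \<in> R
      | Inr (e, i) \<Rightarrow> e \<in> arcs G \<longrightarrow> tail G e \<in> R \<or> head G e \<in> R)" for y :: "'v + 'e \<times> nat"
  have Q_step: "Q z" if "Q y" and step: "(y, z) \<in> Restr (adj (stretch G l)) S" for y z
  proof -
    obtain e i where e: "e \<in> arcs G" and
      yz: "y \<in> {Inl (tail G e), Inl (head G e)} \<union> range (\<lambda>j. Inr (e, j))"
      "z \<in> {Inl (tail G e), Inl (head G e)} \<union> range (\<lambda>j. Inr (e, j))"
      using step by (fastforce simp: adj_def stretch_def split: if_splits)
    have end_in_R: "tail G e \<in> R \<or> head G e \<in> R"
      using \<open>Q y\<close> yz(1) e by (auto simp: Q_def)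
    have "v \<in> R" if "z = Inl v" for v
    proof -
      have "v \<in> T"
        using step that by (simp add: T_def)
      moreover have "(tail G e, head G e) \<in> adj G" "(head G e, tail G e) \<in> adj G"
        using e by (auto simp: adj_def)
      moreover have "v = tail G e \<or> v = head G e"
        using yz(2) that by auto
      ultimately show ?thesis
        using end_in_R R_step by blast
    qed
    then show ?thesis
      using end_in_R yz(2) by (auto simp: Q_def)
  qed
  have "Q x"
    using x \<open>P \<subseteq> R\<close> by (auto simp: Q_def split: sum.splits)
  have Q: "Q y" if "y \<in> S" for y
  proof -
    have "(x, y) \<in> (Restr (adj (stretch G l)) S)\<^sup>*"
      using S that by (simp add: connected_sets_from_iff)
    then show ?thesis
      using \<open>Q x\<close> Q_step by (induction rule: rtrancl_induct) blast+
  qed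
  have SV: "S \<subseteq> verts (stretch G l)" and "finite S"
    using S by (auto simp: connected_sets_from_iff)
  have "T \<subseteq> R"
    using Q[of "Inl _"] \<open>P \<subseteq> R\<close> by (auto simp: T_def Q_def)
  moreover have "T \<subseteq> verts G"
    using P SV by (auto simp: T_def connected_sets_from_iff stretch_def)
  moreover have "finite T"
    using P \<open>finite S\<close> unfolding T_def
    by (auto simp: connected_sets_from_iff vimage_def[symmetric] intro!: finite_vimageI)
  ultimately show "T \<in> connected_sets_from G b 0"
    using \<open>b \<in> T\<close> by (auto simp: connected_sets_from_iff R_def)
  show "S \<subseteq> Inl ` T \<union> Inr ` (SIGMA e:touching G T. {..<l e})"
  proof
    fix y assume y: "y \<in> S"
    show "y \<in> Inl ` T \<union> Inr ` (SIGMA e:touching G T. {..<l e})"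
    proof (cases y)
      case (Inl v)
      then show ?thesis
        using y by (simp add: T_def)
    next
      case (Inr z)
      then obtain e i where "y = Inr (e, i)"
        by (cases z) auto
      moreover from this y SV have "e \<in> arcs G" "i < l e"
        by (auto simp: stretch_def)
      moreover from calculation Q[OF y] \<open>R \<subseteq> T\<close> have "e \<in> touching G T"
        by (auto simp: Q_def touching_def)
      ultimately show ?thesis
        by auto
    qed
  qed
qed

text \<open>
  The deterministic part of the argument: it needs the total length of the edges touching a large
  connected set to be at most linear in the number of its vertices.
\<close>

lemma anchored_expansion_stretch_pos:
  fixes c C :: real
  assumes wf: "wf_digraph G" and conn: "Digraph_Component.connected G" and b: "b \<in> verts G"
    and fin_touching: "\<And>S. finite S \<Longrightarrow> finite (touching G S)"
    and fin_sets: "\<And>n. finite {T \<in> connected_sets_from G b 0. card T = n}"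
    and c: "c > 0" "\<And>T. T \<in> connected_sets_from G b N \<Longrightarrow>
                      c * real (card T) \<le> real (card (edge_boundary G T))"
    and C: "C \<ge> 0" "\<And>T. T \<in> connected_sets_from G b N' \<Longrightarrow>
                      real (\<Sum>e\<in>touching G T. l e) \<le> C * real (card T)"
    and len: "\<And>e. e \<in> arcs G \<Longrightarrow> 1 \<le> l e"
    and x: "x \<in> verts (stretch G l)"
  shows "anchored_expansion (stretch G l) x > 0"
proof -
  define v where "v = (case x of Inl v \<Rightarrow> v | Inr (e, i) \<Rightarrow> tail G e)"
  have "v \<in> verts G"
    using x wf_digraph.wellformed[OF wf] by (auto simp: v_def stretch_def)
  then obtain P where P: "P \<in> connected_sets_from G b 0" "v \<in> P"
    using ex_connected_set_containing[OF wf conn b] by blast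
  define k where "k = card (touching G P)"
  define n where "n = max (max N N') (nat \<lceil>2 * real k / c\<rceil>)"
  \<comment> \<open>If \<open>card T > n\<close>, both hypotheses on large sets apply to \<open>T\<close>, and the \<open>k\<close> edges touching \<open>P\<close>
      make up at most half of the lower bound for the boundary of \<open>T\<close>. There are finitely many
      smaller \<open>T\<close>, so they can only come from sets \<open>S\<close> of at most \<open>K\<close> vertices.\<close>
  define room where "room T = card T + (\<Sum>e\<in>touching G T. l e)" for T
  define W where "W = {T \<in> connected_sets_from G b 0. card T \<le> n}"
  define K where "K = (\<Sum>T\<in>W. room T)"
  have "W = (\<Union>m\<le>n. {T \<in> connected_sets_from G b 0. card T = m})"
    by (auto simp: W_def)
  then have "finite W"
    using fin_sets by simp
  show ?thesis
  proof (rule anchored_expansion_posI)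
    show "c / (2 * (1 + C)) > 0"
      using c(1) C(1) by simp
    fix S assume "S \<in> connected_sets_from (stretch G l) x (Suc K)"
    then have S: "S \<in> connected_sets_from (stretch G l) x 0" "K < card S"
      by (auto simp: connected_sets_from_iff)
    define T where "T = {v. Inl v \<in> S} \<union> P"
    have "case x of Inl v \<Rightarrow> v \<in> P | Inr (e, i) \<Rightarrow> tail G e \<in> P"
      using P(2) by (auto simp: v_def split: sum.splits)
    note T = connected_set_in_stretch[OF wf S(1) P(1) this, folded T_def]
    have "finite T" "finite P"
      using T(1) P(1) by (auto simp: connected_sets_from_iff)
    let ?E = "SIGMA e:touching G T. {..<l e}"
    have "finite ?E"
      using fin_touching[OF \<open>finite T\<close>] by auto
    have "card S \<le> card (Inl ` T \<union> Inr ` ?E :: ('a + 'b \<times> nat) set)"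
      using T(2) \<open>finite T\<close> \<open>finite ?E\<close> by (intro card_mono) auto
    also have "\<dots> \<le> card (Inl ` T :: ('a + 'b \<times> nat) set) + card (Inr ` ?E :: ('a + 'b \<times> nat) set)"
      by (rule card_Un_le)
    also have "\<dots> = card T + card ?E"
      by (simp add: card_image)
    also have "\<dots> = room T"
      using fin_touching[OF \<open>finite T\<close>] by (simp add: room_def)
    finally have "card S \<le> room T" .
    have "n < card T"
    proof (rule ccontr)
      assume "\<not> n < card T"
      then have "T \<in> W"
        using T(1) by (simp add: W_def)
      then have "room T \<le> K"
        unfolding K_def using \<open>finite W\<close> by (intro member_le_sum) auto
      then show False
        using \<open>card S \<le> room T\<close> S(2) by simp
    qed
    then have large: "T \<in> connected_sets_from G b N" "T \<in> connected_sets_from G b N'"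
      "2 * real k / c \<le> real (card T)"
      using T(1) by (auto simp: n_def connected_sets_from_iff) linarith
    have "edge_boundary (stretch G l) S \<subseteq> ?E"
      using T(2)
      by (auto simp: edge_boundary_def touching_def stretch_def T_def split: if_splits)
    then have fin: "finite (edge_boundary (stretch G l) S)"
      using \<open>finite ?E\<close> finite_subset by blast
    have "edge_boundary G T \<subseteq> edge_boundary G {v. Inl v \<in> S} \<union> touching G P"
      by (auto simp: T_def edge_boundary_def touching_def)
    moreover have "finite (edge_boundary G {v. Inl v \<in> S})"
      using fin_touching[of "{v. Inl v \<in> S}"] \<open>finite T\<close> edge_boundary_subset_touching finite_subset
      by (metis T_def finite_Un)
    ultimately have "card (edge_boundary G T) \<le> card (edge_boundary G {v. Inl v \<in> S}) + k"
      unfolding k_def using fin_touching[OF \<open>finite P\<close>]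
      by (meson card_Un_le card_mono finite_UnI order_trans)
    also have "\<dots> \<le> card (edge_boundary (stretch G l) S) + k"
      using card_edge_boundary_le_stretch[OF len fin] by simp
    finally have "c * real (card T) \<le> real (card (edge_boundary (stretch G l) S)) + real k"
      using c(2)[OF large(1)] by linarith
    moreover have "2 * real k \<le> c * real (card T)"
      using large(3) c(1) by (simp add: field_simps)
    ultimately have 1: "c / 2 * real (card T) \<le> real (card (edge_boundary (stretch G l) S))"
      by linarith
    have "real (card S) \<le> real (card T) + real (\<Sum>e\<in>touching G T. l e)"
      using \<open>card S \<le> room T\<close> unfolding room_def by linarith
    then have "real (card S) \<le> (1 + C) * real (card T)"
      using C(2)[OF large(2)] by (simp add: algebra_simps)
    then have "c / (2 * (1 + C)) * real (card S) \<le> c / (2 * (1 + C)) * ((1 + C) * real (card T))"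
      using c(1) C(1) by (intro mult_left_mono) auto
    also have "\<dots> = c / 2 * real (card T)"
      using C(1) by (simp add: field_simps)
    finally show "c / (2 * (1 + C)) * real (card S) \<le> real (card (edge_boundary (stretch G l) S))"
      using 1 by linarith
  qed
qed

section \<open>Random stretches\<close>

theorem theorem1p2:
  fixes G :: "('v, 'e) pre_digraph"
    and b :: 'v
    and \<nu> :: "nat pmf"
    and M :: "'w measure"
    and L :: "'e \<Rightarrow> 'w \<Rightarrow> nat"
  assumes "wf_digraph G"
    and "infinite (verts G)"
    and "Digraph_Component.connected G"
    and "bounded_degree G"
    and "b \<in> verts G"
    and "anchored_expansion G b > 0"
    and "0 \<notin> set_pmf \<nu>"
    and "exponential_tail \<nu>"
    and "prob_space M"
    and "prob_space.indep_vars M (\<lambda>_. count_space UNIV) L (arcs G)"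
    and "\<And>e. e \<in> arcs G \<Longrightarrow> distr M (count_space UNIV) (L e) = measure_pmf \<nu>"
  shows "AE \<omega> in M. \<forall>x \<in> verts (stretch G (\<lambda>e. L e \<omega>)).
           anchored_expansion (stretch G (\<lambda>e. L e \<omega>)) x > 0"
proof -
  note wf = assms(1) and conn = assms(3) and b = assms(5) and law = assms(11)
  interpret prob_space M by fact
  obtain D where D: "1 \<le> D" "\<And>v. finite (adj G `` {v})" "\<And>v. card (adj G `` {v}) \<le> D"
    "\<And>S. finite S \<Longrightarrow> finite (touching G S) \<and> card (touching G S) \<le> D * card S"
    using bounded_degreeE[OF wf assms(4)] by metis
  let ?A = "\<lambda>n. {T \<in> connected_sets_from G b 0. card T = n}"
  have A: "finite (?A n)" "card (?A n) \<le> (D ^ 2) ^ n" for n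
  proof -
    note count = card_connected_sets[OF D(2,3), of b n]
    then show "finite (?A n)"
      by blast
    have "card (?A n) \<le> D ^ (2 * (n - 1))"
      using count by blast
    also have "\<dots> \<le> D ^ (2 * n)"
      using D(1) by (intro power_increasing) auto
    finally show "card (?A n) \<le> (D ^ 2) ^ n"
      by (simp add: power_mult)
  qed
  have fin_touching: "finite (touching G S)" if "finite S" for S
    using D(4)[OF that] by blast
  obtain c N where c: "c > 0"
    "\<And>S. S \<in> connected_sets_from G b N \<Longrightarrow> c * real (card S) \<le> real (card (edge_boundary G S))"
    using anchored_expansion_posD[OF assms(6)] by metis
  have "\<exists>C\<ge>0. AE \<omega> in M. \<forall>\<^sub>F n in sequentially.
      \<forall>J\<in>touching G ` ?A n. real (\<Sum>e\<in>J. L e \<omega>) \<le> C * real n"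
  proof (rule eventually_all_sums_le_linear[OF assms(10) law assms(8)])
    show "finite (touching G ` ?A n)" for n
      using A(1) by simp
    show "card (touching G ` ?A n) \<le> (D ^ 2) ^ n" for n
      using A card_image_le order_trans by blast
    show "J \<subseteq> arcs G \<and> finite J \<and> card J \<le> D * n" if "J \<in> touching G ` ?A n" for n J
      using that D(4) by (auto simp: connected_sets_from_iff touching_def)
  qed
  then obtain C where C: "C \<ge> 0" "AE \<omega> in M. \<forall>\<^sub>F n in sequentially.
      \<forall>J\<in>touching G ` ?A n. real (\<Sum>e\<in>J. L e \<omega>) \<le> C * real n"
    by blast
  have "AE \<omega> in M. L e \<omega> \<noteq> 0" if e: "e \<in> arcs G" for e
  proof -
    have "L e \<in> measurable M (count_space UNIV)"
      using assms(10) e by (auto simp: indep_vars_def)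
    moreover have "AE k in distr M (count_space UNIV) (L e). k \<noteq> 0"
      unfolding law[OF e] using assms(7) by (intro AE_pmfI) metis
    ultimately show ?thesis
      by (subst (asm) AE_distr_iff) auto
  qed
  moreover have "countable (arcs G)"
    using countable_arcs[OF wf conn b fin_touching A(1)] by blast
  ultimately have "AE \<omega> in M. \<forall>e\<in>arcs G. L e \<omega> \<noteq> 0"
    by (simp add: AE_ball_countable)
  with C(2) show ?thesis
  proof eventually_elim
    case (elim \<omega>)
    then obtain N' where N': "\<And>n T. \<lbrakk>N' \<le> n; T \<in> ?A n\<rbrakk> \<Longrightarrow>
        real (\<Sum>e\<in>touching G T. L e \<omega>) \<le> C * real n"
      unfolding eventually_sequentially by blast
    show ?case
    proof
      fix x assume x: "x \<in> verts (stretch G (\<lambda>e. L e \<omega>))"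
      show "anchored_expansion (stretch G (\<lambda>e. L e \<omega>)) x > 0"
      proof (rule anchored_expansion_stretch_pos[OF wf conn b fin_touching A(1) c C(1) _ _ x])
        show "real (\<Sum>e\<in>touching G T. L e \<omega>) \<le> C * real (card T)"
          if "T \<in> connected_sets_from G b N'" for T
          using that N'[of "card T" T] by (simp add: connected_sets_from_iff)
        show "1 \<le> L e \<omega>" if "e \<in> arcs G" for e
          using elim(2) that by (simp add: Suc_le_eq)
      qed
    qed
  qed
qed

end
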